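(* Let $N\ge2$, $d=\pi(N)$, $p_1<\dots<p_d$ the primes up to $N$, and for $n=\prod_jp_j^{\kappa_j}\le N$ let $z(n)=\prod_jz_j^{\kappa_j}$ for $z\in\mathbb{T}^d$. Set $F_N(z)=\sum_{n=1}^Nz(n)/\sqrt n$. Fix $\varepsilon>0$. If $q\ge N^\varepsilon$, then \[\|F_N\|_{L^q(\mathbb{T}^{\pi(N)})}\gg_\varepsilon\sqrt N\] as $N\to\infty$, where $\|F\|_{L^q(\mathbb{T}^d)}=\big(\int_{\mathbb{T}^d}|F(z)|^q\,d\mu_d(z)\big)^{1/q}$.
   Context: $\mathbb{T}^d$ is the polytorus $\{(z_1,\dots,z_d):|z_j|=1\}$ with normalized product Lebesgue (Haar) measure $\mu_d$; $\pi(N)$ is the number of primes $\le N$. The implied constant depends only on $\varepsilon$. *)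

theory Defs
  imports "HOL-Probability.Probability" "HOL-Computational_Algebra.Primes"
begin

definition circle_haar :: "complex measure" where
  "circle_haar = distr (uniform_measure lborel {0..1::real}) borel (\<lambda>t. cis (2 * pi * t))"

text \<open>The primes up to N; they index the coordinates of the polytorus.\<close>
definition primes_upto :: "nat \<Rightarrow> nat set" where
  "primes_upto N = {p. prime p \<and> p \<le> N}"

definition torus_haar :: "nat set \<Rightarrow> (nat \<Rightarrow> complex) measure" where
  "torus_haar P = PiM P (\<lambda>_. circle_haar)"

definition zmon :: "(nat \<Rightarrow> complex) \<Rightarrow> nat \<Rightarrow> complex" where
  "zmon z n = (\<Prod>p\<in>prime_factors n. z p ^ multiplicity p n)"

definition F_N :: "nat \<Rightarrow> (nat \<Rightarrow> complex) \<Rightarrow> complex" where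
  "F_N N z = (\<Sum>n=1..N. zmon z n / complex_of_real (sqrt (real n)))"

definition Lq_norm_torus :: "nat set \<Rightarrow> real \<Rightarrow> ((nat \<Rightarrow> complex) \<Rightarrow> complex) \<Rightarrow> real" where
  "Lq_norm_torus P q F = (\<integral>z. norm (F z) powr q \<partial>torus_haar P) powr (1 / q)"

end

theory Submission
  imports Defs "HOL-Real_Asymp.Real_Asymp"
begin

text \<open>
  Only the small primes p \<le> y = N^(\<epsilon>/2) are needed. Let B be the set of z with |z_p - 1| \<le> 1/(2N)
  for all such p, the other coordinates being free. Integrating F_N over B kills every n with a
  prime factor exceeding y, while Re z(n) \<ge> 1/2 on B for every y-smooth n \<le> N. A positive proportion
  of the n \<le> N is y-smooth, so the mean of |F_N| over B is \<gg> \<surd>N, and by convexity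
  ||F_N||_q \<gg> \<surd>N \<mu>(B)^(1/q). Here \<mu>(B) \<ge> (4\<pi>N)^(-y), and y/q \<le> N^(-\<epsilon>/2) makes the last
  factor tend to 1.

  The smooth numbers are counted by raising x from w^(8+j) to w^(9+j), where y = w^8: multiply the
  smooth numbers up to x/p by p, for primes p in (w, w^8]. Each product arises at most 9+j times, and
  the primes in (w, w^8] have reciprocal sum at least 1/8. The last fact needs no sharp form of
  Mertens' theorem: comparing the factorization of n! with ln(n!) = n ln n + O(n) bounds the sum of
  (ln p)/p over p \<le> n from below by ln n - O(1) and from above by 2 ln n.
\<close>

section \<open>Chebyshev-type bounds for sums over primes\<close>

lemma finite_primes_upto [simp]: "finite (primes_upto N)"
  unfolding primes_upto_def by (rule finite_subset[of _ "{..N}"]) auto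

text \<open>Legendre's formula in recursive form: the multiples of p up to n contribute p^k k! with
  k = n div p. In the induction on n both sides change only when p divides \<open>Suc n\<close>, and
  then the quotient rises by one.\<close>

lemma multiplicity_fact_rec:
  fixes p n :: nat
  assumes p: "prime p"
  shows "multiplicity p (fact n) = n div p + multiplicity p (fact (n div p))"
proof (induction n)
  case 0
  show ?case by simp
next
  case (Suc n)
  have p2: "p \<ge> 2" using p by (rule prime_ge_2_nat)
  have mult_Suc: "multiplicity p (fact (Suc k)) = multiplicity p (Suc k) + multiplicity p (fact k)" for k
    using p by (simp add: prime_elem_multiplicity_mult_distrib del: mult_Suc)
  show ?case
  proof (cases "p dvd Suc n")
    case False
    hence "Suc n div p = n div p"
      by (simp add: div_Suc dvd_eq_mod_eq_0)
    moreover have "multiplicity p (Suc n) = 0"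
      using False by (rule not_dvd_imp_multiplicity_0)
    ultimately show ?thesis using Suc mult_Suc[of n] by simp
  next
    case True
    then obtain m where m: "Suc n = p * m" by (elim dvdE)
    then obtain k where k: "m = Suc k" by (cases m) auto
    have "Suc n div p = Suc k" using m k p2 by simp
    moreover from this have "n div p = k"
      using True by (simp add: div_Suc dvd_eq_mod_eq_0)
    moreover have "multiplicity p (Suc n) = Suc (multiplicity p (Suc k))"
      using p k p2 unfolding m by (simp add: prime_elem_multiplicity_mult_distrib del: mult_Suc mult_Suc_right)
    ultimately show ?thesis using Suc mult_Suc[of n] mult_Suc[of k] by simp
  qed
qed

text \<open>This is the geometric series bound n/p + n/p^2 + ... = n/(p - 1), kept in integers. With
  k = n div p, the recursion reduces it to k (p - 1) + k = k p, which is at most n.\<close>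

lemma multiplicity_fact_le:
  fixes p n :: nat
  assumes p: "prime p"
  shows "multiplicity p (fact n) * (p - 1) \<le> n"
proof (induction n rule: less_induct)
  case (less n)
  have p2: "p \<ge> 2" using p by (rule prime_ge_2_nat)
  show ?case
  proof (cases "n = 0")
    case False
    hence "n div p < n" using p2 by simp
    from less[OF this] have "multiplicity p (fact n) * (p - 1) \<le> n div p * (p - 1) + n div p"
      by (subst multiplicity_fact_rec[OF p]) (simp add: add_mult_distrib)
    also have "\<dots> = n div p * p" using p2 by (cases p) auto
    also have "\<dots> \<le> n" by simp
    finally show ?thesis .
  qed auto
qed

lemma ln_fact_conv_primes:
  "ln (fact n :: real) = (\<Sum>p\<in>primes_upto n. real (multiplicity p (fact n :: nat)) * ln (real p))"
proof -
  have "ln (fact n :: real) = ln (real (\<Prod>p\<in>prime_factors (fact n). p ^ multiplicity p (fact n)))"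
    using prime_factorization_nat[of "fact n"] by simp
  also have "\<dots> = (\<Sum>p\<in>prime_factors (fact n). ln (real p ^ multiplicity p (fact n)))"
    by (auto simp: in_prime_factors_iff prime_gt_0_nat intro!: ln_prod)
  also have "\<dots> = (\<Sum>p\<in>prime_factors (fact n). real (multiplicity p (fact n)) * ln (real p))"
    by (intro sum.cong refl ln_realpow)
  also have "\<dots> = (\<Sum>p\<in>primes_upto n. real (multiplicity p (fact n)) * ln (real p))"
    by (intro sum.mono_neutral_left)
       (auto simp: primes_upto_def in_prime_factors_iff prime_dvd_fact_iff not_dvd_imp_multiplicity_0)
  finally show ?thesis .
qed

text \<open>Stirling's crude bound n! >= (n/e)^n is played against the upper bound n/(p - 1) for the
  exponent of p in n!.\<close>

lemma sum_ln_over_pred_primes_ge: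
  assumes "n \<ge> 1"
  shows "(\<Sum>p\<in>primes_upto n. ln (real p) / (real p - 1)) \<ge> ln (real n) - 1"
proof -
  have "real n ^ n / fact n \<le> exp (real n)"
  proof -
    \<comment> \<open>The left-hand side is a single term of the exponential series at n.\<close>
    have "real n ^ n /\<^sub>R fact n \<le> (\<Sum>k. real n ^ k /\<^sub>R fact k)"
      by (rule sum_le_suminf[of _ "{n}", simplified]) (auto simp: summable_exp)
    thus ?thesis by (simp add: exp_def field_simps)
  qed
  hence "ln (real n ^ n / fact n) \<le> real n"
    using assms by (subst ln_exp[symmetric], subst ln_le_cancel_iff) auto
  hence "real n * ln (real n) - real n \<le> ln (fact n :: real)"
    using assms by (simp add: ln_div ln_realpow)
  also have "\<dots> \<le> (\<Sum>p\<in>primes_upto n. real n / (real p - 1) * ln (real p))"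
    unfolding ln_fact_conv_primes
  proof (intro sum_mono mult_right_mono)
    fix p assume "p \<in> primes_upto n"
    hence p: "prime p" by (simp add: primes_upto_def)
    hence p1: "p > 1" by (rule prime_gt_1_nat)
    have "real (multiplicity p (fact n :: nat) * (p - 1)) \<le> real n"
      using multiplicity_fact_le[OF p] by (subst of_nat_le_iff)
    thus "real (multiplicity p (fact n :: nat)) \<le> real n / (real p - 1)"
      using p1 by (simp add: field_simps of_nat_diff)
    show "0 \<le> ln (real p)" using p1 by simp
  qed
  also have "\<dots> = real n * (\<Sum>p\<in>primes_upto n. ln (real p) / (real p - 1))"
    by (simp add: sum_distrib_left)
  finally have "real n * (ln (real n) - 1) \<le> real n * (\<Sum>p\<in>primes_upto n. ln (real p) / (real p - 1))"
    by (simp add: algebra_simps)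
  thus ?thesis using assms by simp
qed

text \<open>Here the exponent of p in n! is bounded below by its first Legendre term n div p, and n!
  is bounded above by n^n.\<close>

lemma sum_ln_over_primes_le:
  assumes "n \<ge> 1"
  shows "(\<Sum>p\<in>primes_upto n. ln (real p) / real p) \<le> 2 * ln (real n)"
proof -
  have "real n * (\<Sum>p\<in>primes_upto n. ln (real p) / real p)
          = (\<Sum>p\<in>primes_upto n. real n / real p * ln (real p))"
    by (simp add: sum_distrib_left)
  also have "\<dots> \<le> (\<Sum>p\<in>primes_upto n. 2 * real (multiplicity p (fact n :: nat)) * ln (real p))"
  proof (intro sum_mono mult_right_mono)
    fix p assume "p \<in> primes_upto n"
    hence p: "prime p" and pn: "p \<le> n" by (simp_all add: primes_upto_def)
    hence p1: "p > 1" by (metis prime_gt_1_nat)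
    have "n div p \<ge> 1" using pn p1 by (simp add: div_greater_zero_iff Suc_le_eq)
    \<comment> \<open>Since the quotient is at least 1, the remainder is less than p (n div p).
      Dropping the floor thus costs a factor 2, the source of the 2 in the lemma.\<close>
    hence "p * 1 \<le> p * (n div p)" by (intro mult_left_mono) auto
    moreover have "n = p * (n div p) + n mod p" by simp
    moreover have "n mod p < p" using p1 by simp
    ultimately have "n \<le> 2 * (p * (n div p))" by linarith
    also have "\<dots> \<le> 2 * (p * multiplicity p (fact n :: nat))"
      using multiplicity_fact_rec[OF p, of n] by simp
    finally have "real n \<le> real (2 * (p * multiplicity p (fact n :: nat)))" by (subst of_nat_le_iff)
    thus "real n / real p \<le> 2 * real (multiplicity p (fact n :: nat))"
      using p1 by (simp add: field_simps)
    show "0 \<le> ln (real p)" using p1 by simp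
  qed
  also have "\<dots> = 2 * ln (fact n :: real)"
    by (simp add: ln_fact_conv_primes sum_distrib_left mult.assoc)
  also have "ln (fact n :: real) \<le> ln (real n ^ n)"
    using fact_le_power[of n, where 'a = real] by (subst ln_le_cancel_iff) (use assms in auto)
  also have "\<dots> = real n * ln (real n)" using assms by (simp add: ln_realpow)
  finally have "real n * (\<Sum>p\<in>primes_upto n. ln (real p) / real p) \<le> real n * (2 * ln (real n))"
    by (simp add: algebra_simps)
  thus ?thesis using assms by simp
qed

text \<open>The lower bound for primes up to w^8 exceeds the upper bound for primes up to w, so the
  primes in between carry weight of order ln w. There ln p is at most 8 ln w, which turns the
  weights (ln p)/p into 1/p.\<close>

lemma sum_inverse_primes_ge:
  fixes w :: real
  assumes w: "w \<ge> exp 1"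
  shows "(\<Sum>p | prime p \<and> w < real p \<and> real p \<le> w ^ 8. 1 / real p) \<ge> 1 / 8"
proof -
  define m n where "m = nat \<lfloor>w\<rfloor>" and "n = nat \<lfloor>w ^ 8\<rfloor>"
  define P where "P = {p. prime p \<and> w < real p \<and> real p \<le> w ^ 8}"
  have w2: "w \<ge> 2" using w exp_ge_add_one_self[of 1] by linarith
  have lnw: "ln w \<ge> 1" using w w2 by (subst ln_ge_iff) auto
  have w8: "w \<le> w ^ 8" using w2 by (intro self_le_power) auto
  have m1: "m \<ge> 1" and n1: "n \<ge> 1" unfolding m_def n_def using w2 w8 by (simp_all add: le_nat_iff le_floor_iff)
  have mw: "real p \<le> w \<longleftrightarrow> p \<le> m" for p
    unfolding m_def using w2 by (simp add: le_nat_iff le_floor_iff)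
  have nw: "real p \<le> w ^ 8 \<longleftrightarrow> p \<le> n" for p
    unfolding n_def using w2 by (simp add: le_nat_iff le_floor_iff)
  have mn: "m \<le> n" using mw[of m] nw[of m] w8 by auto
  have P_eq: "P = primes_upto n - primes_upto m"
    unfolding P_def primes_upto_def using mw nw by (auto simp: not_le[symmetric])
  have n_lower: "w ^ 8 / 2 \<le> real n"
    unfolding n_def using w2 w8 by linarith
  have lnn: "ln (real n) \<ge> 8 * ln w - 1"
  proof -
    have "8 * ln w - 1 \<le> 8 * ln w - ln 2" using ln_2_less_1 by simp
    also have "\<dots> = ln (w ^ 8 / 2)" using w2 by (simp add: ln_div ln_realpow)
    also have "\<dots> \<le> ln (real n)" using n_lower w2 n1 by (subst ln_le_cancel_iff) auto
    finally show ?thesis .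
  qed
  \<comment> \<open>The two earlier bounds carry different weights, 1/(p - 1) and 1/p. Passing
    between them costs at most a factor 2, as p >= 2.\<close>
  have step: "ln (real p) / (real p - 1) \<le> 2 * (ln (real p) / real p)" if "prime p" for p
  proof -
    have "p \<ge> 2" using that by (rule prime_ge_2_nat)
    thus ?thesis by (simp add: field_simps)
  qed
  have "(\<Sum>p\<in>primes_upto m. ln (real p) / (real p - 1)) \<le> (\<Sum>p\<in>primes_upto m. 2 * (ln (real p) / real p))"
    by (intro sum_mono step) (auto simp: primes_upto_def)
  also have "\<dots> \<le> 4 * ln (real m)"
    using sum_ln_over_primes_le[OF m1] by (subst sum_distrib_left[symmetric]) simp
  also have "ln (real m) \<le> ln w" using mw[of m] m1 w2 by simp
  finally have small: "(\<Sum>p\<in>primes_upto m. ln (real p) / (real p - 1)) \<le> 4 * ln w" by simp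
  have "(\<Sum>p\<in>P. ln (real p) / (real p - 1)) =
          (\<Sum>p\<in>primes_upto n. ln (real p) / (real p - 1)) - (\<Sum>p\<in>primes_upto m. ln (real p) / (real p - 1))"
    unfolding P_eq using mn by (intro sum_diff) (auto simp: primes_upto_def)
  \<comment> \<open>The balance is (8 ln w - 1) - 1 - 4 ln w = 4 ln w - 2, and this is at least 2 ln
    w because ln w >= 1. The exponent 8 leaves room for the losses in both bounds.\<close>
  hence "2 * ln w \<le> (\<Sum>p\<in>P. ln (real p) / (real p - 1))"
    using small sum_ln_over_pred_primes_ge[OF n1] lnn lnw by linarith
  also have "\<dots> \<le> (\<Sum>p\<in>P. 16 * ln w * (1 / real p))"
  proof (rule sum_mono)
    fix p assume "p \<in> P"
    hence p: "prime p" "real p \<le> w ^ 8" by (auto simp: P_def)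
    have p2: "p \<ge> 2" using p(1) by (rule prime_ge_2_nat)
    have "ln (real p) \<le> ln (w ^ 8)" using p p2 w2 by (subst ln_le_cancel_iff) auto
    also have "\<dots> = 8 * ln w" using w2 by (simp add: ln_realpow)
    finally have "2 * (ln (real p) / real p) \<le> 2 * (8 * ln w / real p)"
      by (intro mult_left_mono divide_right_mono) auto
    with step[OF p(1)] show "ln (real p) / (real p - 1) \<le> 16 * ln w * (1 / real p)" by simp
  qed
  also have "\<dots> = 16 * ln w * (\<Sum>p\<in>P. 1 / real p)" by (simp add: sum_distrib_left)
  finally have "ln w * (1 / 8) \<le> ln w * (\<Sum>p\<in>P. 1 / real p)" by simp
  thus ?thesis using lnw unfolding P_def by simp
qed


section \<open>A positive proportion of smooth numbers\<close>

definition smooth_upto :: "real \<Rightarrow> real \<Rightarrow> nat set" where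
  "smooth_upto y x = {n. n \<ge> 1 \<and> real n \<le> x \<and> (\<forall>p\<in>prime_factors n. real p \<le> y)}"

lemma finite_smooth_upto [simp]: "finite (smooth_upto y x)"
  unfolding smooth_upto_def
  by (rule finite_subset[of _ "{..nat \<lfloor>x\<rfloor>}"]) (auto simp: le_nat_floor)

text \<open>The distinct primes in question have a product dividing n, and each exceeds w, so w to
  the power of their number is at most w^K.\<close>

lemma card_large_prime_factors:
  fixes w :: real
  assumes "w > 1" "n \<ge> 1" "real n \<le> w ^ K"
  shows "card {p. prime p \<and> p dvd n \<and> w < real p} \<le> K"
proof -
  define Q where "Q = {p. prime p \<and> p dvd n \<and> w < real p}"
  have Q: "Q \<subseteq> prime_factors n" using assms(2) by (auto simp: Q_def in_prime_factors_iff)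
  have finQ: "finite Q" using Q by (rule finite_subset) simp
  have "\<Prod>Q dvd (\<Prod>p\<in>prime_factors n. p)"
    using Q by (intro prod_dvd_prod_subset) auto
  also have "\<dots> dvd (\<Prod>p\<in>prime_factors n. p ^ multiplicity p n)"
    by (intro prod_dvd_prod dvd_power) (auto simp: prime_factors_multiplicity)
  also have "\<dots> = n" using assms(2) by (intro prime_factorization_nat[symmetric]) auto
  finally have "\<Prod>Q \<le> n" using assms(2) by (intro dvd_imp_le) auto
  have "w ^ card Q = (\<Prod>p\<in>Q. w)" by simp
  also have "\<dots> \<le> (\<Prod>p\<in>Q. real p)" using assms(1) by (intro prod_mono) (auto simp: Q_def)
  also have "\<dots> = real (\<Prod>Q)" by simp
  also have "\<dots> \<le> real n" using \<open>\<Prod>Q \<le> n\<close> by (subst of_nat_le_iff)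
  also have "\<dots> \<le> w ^ K" by fact
  finally have "card Q \<le> K" using assms(1) by (simp add: power_le_imp_le_exp)
  thus ?thesis by (simp add: Q_def)
qed

text \<open>The constant depends on j alone and is uniform in w and x. This matters because w will
  grow with N while j stays fixed.\<close>

lemma card_smooth_upto_ge_aux:
  fixes j :: nat
  shows "\<exists>c>0. \<forall>w x::real. w \<ge> exp 1 \<longrightarrow> 1 \<le> x \<longrightarrow> x \<le> w ^ (8 + j) \<longrightarrow>
           real (card (smooth_upto (w ^ 8) x)) \<ge> c * x"
proof (induction j)
  case 0
  have "real (card (smooth_upto (w ^ 8) x)) \<ge> 1 / 2 * x" if x: "1 \<le> x" "x \<le> w ^ 8" for w x :: real
  proof -
    have "{1..nat \<lfloor>x\<rfloor>} \<subseteq> smooth_upto (w ^ 8) x"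
    proof
      fix n assume n: "n \<in> {1..nat \<lfloor>x\<rfloor>}"
      hence nx: "real n \<le> x" using x by (simp add: le_nat_iff le_floor_iff)
      have "real p \<le> w ^ 8" if "p \<in> prime_factors n" for p
      proof -
        have "p \<le> n" using that n by (intro dvd_imp_le) auto
        with nx x show ?thesis by linarith
      qed
      with n nx show "n \<in> smooth_upto (w ^ 8) x" by (auto simp: smooth_upto_def)
    qed
    from card_mono[OF _ this] have "nat \<lfloor>x\<rfloor> \<le> card (smooth_upto (w ^ 8) x)" by simp
    moreover have "1 / 2 * x \<le> real (nat \<lfloor>x\<rfloor>)" using x by (simp add: of_nat_nat) (smt (verit) le_floor_iff floor_less_iff of_int_1 of_int_1_le_iff real_of_int_floor_add_one_gt)
    ultimately show ?thesis by linarith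
  qed
  thus ?case by (intro exI[of _ "1 / 2"]) auto
next
  case (Suc j)
  then obtain c where c: "c > 0" and IH: "\<And>w x::real. w \<ge> exp 1 \<Longrightarrow> 1 \<le> x \<Longrightarrow> x \<le> w ^ (8 + j) \<Longrightarrow>
      real (card (smooth_upto (w ^ 8) x)) \<ge> c * x" by metis
  \<comment> \<open>The 8 is the loss from the reciprocal sum over primes, and 9 + j bounds how
    often the same product p m is counted.\<close>
  define c' where "c' = c / (8 * real (9 + j))"
  have c': "c' > 0" "c' \<le> c" using c by (simp_all add: c'_def field_simps)
  have "real (card (smooth_upto (w ^ 8) x)) \<ge> c' * x"
    if w: "w \<ge> exp 1" and x: "1 \<le> x" "x \<le> w ^ (8 + Suc j)" for w x :: real
  proof (cases "x \<le> w ^ (8 + j)")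
    case True
    have "c' * x \<le> c * x" using c' x by (intro mult_right_mono) auto
    with IH[OF w x(1) True] show ?thesis by linarith
  next
    case False
    have w1: "w > 1" using w exp_ge_add_one_self[of 1] by linarith
    define P where "P = {p. prime p \<and> w < real p \<and> real p \<le> w ^ 8}"
    define A where "A = smooth_upto (w ^ 8) x"
    define T where "T = Sigma P (\<lambda>p. smooth_upto (w ^ 8) (x / real p))"
    have finP: "finite P"
    proof (rule finite_subset)
      show "P \<subseteq> {..nat \<lfloor>w ^ 8\<rfloor>}" by (auto simp: P_def le_nat_floor)
    qed simp
    \<comment> \<open>The induction hypothesis is applied at x/p. This needs x >= w^8 >= p, so that
      x/p >= 1, and p > w, which brings x/p below w^(8 + j).\<close>
    have "w ^ 8 \<le> w ^ (8 + j)" using w1 by (intro power_increasing) auto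
    hence xw8: "w ^ 8 \<le> x" using False by linarith
    have "c * x * (1 / 8) \<le> c * x * (\<Sum>p\<in>P. 1 / real p)"
      unfolding P_def using sum_inverse_primes_ge[OF w] c x by (intro mult_left_mono) auto
    also have "\<dots> = (\<Sum>p\<in>P. c * (x / real p))" by (simp add: sum_distrib_left)
    also have "\<dots> \<le> (\<Sum>p\<in>P. real (card (smooth_upto (w ^ 8) (x / real p))))"
    proof (intro sum_mono IH w)
      fix p assume p: "p \<in> P"
      hence p0: "w < real p" "real p \<le> w ^ 8" by (auto simp: P_def)
      show "1 \<le> x / real p" using p0 xw8 w1 by (simp add: field_simps)
      have "x \<le> w ^ (8 + j) * w" using x(2) by (simp only: add_Suc_right power_Suc2)
      also have "\<dots> \<le> w ^ (8 + j) * real p" using p0 w1 by (intro mult_left_mono) auto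
      finally show "x / real p \<le> w ^ (8 + j)" using p0 w1 by (simp add: field_simps)
    qed
    also have "\<dots> = real (card T)" unfolding T_def using finP by (subst card_SigmaI) auto
    also have "card T \<le> card A * (9 + j)"
    proof -
      \<comment> \<open>Double counting: (p, m) is recorded as the product p m together with its
        marked prime p. The map is injective, and the possible marks on n are its prime factors
        above w, at most 9 + j of them because n is at most w^(9 + j).\<close>
      define U where "U = Sigma A (\<lambda>n. {p. prime p \<and> p dvd n \<and> w < real p})"
      have finU: "finite {p. prime p \<and> p dvd n \<and> w < real p}" if "n \<in> A" for n
        by (rule finite_subset[of _ "prime_factors n"])
          (use that in \<open>auto simp: A_def smooth_upto_def in_prime_factors_iff\<close>)
      have "card T \<le> card U"
      proof (rule card_inj_on_le)
        show "inj_on (\<lambda>(p, m). (p * m, p)) T"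
          by (auto simp: inj_on_def T_def P_def dest: prime_gt_0_nat)
        show "(\<lambda>(p, m). (p * m, p)) ` T \<subseteq> U"
        proof clarify
          fix p m assume "(p, m) \<in> T"
          hence p: "prime p" "w < real p" "real p \<le> w ^ 8" and m: "m \<in> smooth_upto (w ^ 8) (x / real p)"
            by (auto simp: T_def P_def)
          have p0: "p > 0" using p(1) by (rule prime_gt_0_nat)
          have m': "m \<ge> 1" "real m \<le> x / real p" using m by (auto simp: smooth_upto_def)
          have "prime_factors (p * m) = insert p (prime_factors m)"
            using p(1) p0 m' by (subst prime_factors_product) (auto simp: prime_prime_factors)
          moreover have "real (p * m) \<le> x" using m' p0 by (simp add: field_simps)
          ultimately have "p * m \<in> A" using m p p0 m' by (auto simp: A_def smooth_upto_def)
          thus "(p * m, p) \<in> U" using p by (auto simp: U_def)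
        qed
        show "finite U" unfolding U_def using finU by (intro finite_SigmaI) (auto simp: A_def)
      qed
      also have "card U = (\<Sum>n\<in>A. card {p. prime p \<and> p dvd n \<and> w < real p})"
        unfolding U_def using finU by (intro card_SigmaI) (auto simp: A_def)
      also have "\<dots> \<le> (\<Sum>n\<in>A. 9 + j)"
        using x(2) w1 by (intro sum_mono card_large_prime_factors) (auto simp: A_def smooth_upto_def)
      finally show ?thesis by simp
    qed
    finally have "c * x * (1 / 8) \<le> real (card A) * real (9 + j)" by (simp add: algebra_simps)
    thus ?thesis by (simp add: A_def c'_def field_simps)
  qed
  with c' show ?case by blast
qed

lemma card_smooth_upto_ge:
  fixes \<delta> :: real
  assumes "\<delta> > 0"
  shows "\<exists>c>0. \<forall>\<^sub>F N::nat in sequentially. real (card (smooth_upto (real N powr \<delta>) (real N))) \<ge> c * real N"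
proof -
  \<comment> \<open>With w = N^(\<open>\<delta>\<close>/8), this choice makes w^(8 + j) at least N,
    while w^8 is exactly the smoothness bound N^\<open>\<delta>\<close>.\<close>
  define j where "j = nat \<lceil>8 / \<delta>\<rceil>"
  have j: "8 / \<delta> \<le> real j" unfolding j_def by linarith
  obtain c where c: "c > 0" and *: "\<And>w x::real. w \<ge> exp 1 \<Longrightarrow> 1 \<le> x \<Longrightarrow> x \<le> w ^ (8 + j) \<Longrightarrow>
      real (card (smooth_upto (w ^ 8) x)) \<ge> c * x"
    using card_smooth_upto_ge_aux[of j] by blast
  have "filterlim (\<lambda>N::nat. real N powr (\<delta> / 8)) at_top sequentially"
    using assms by real_asymp
  hence "\<forall>\<^sub>F N::nat in sequentially. real N powr (\<delta> / 8) \<ge> exp 1"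
    by (simp add: filterlim_at_top)
  with eventually_ge_at_top[of 1]
  have "\<forall>\<^sub>F N::nat in sequentially. real (card (smooth_upto (real N powr \<delta>) (real N))) \<ge> c * real N"
  proof eventually_elim
    case (elim N)
    define w where "w = real N powr (\<delta> / 8)"
    have w8: "w ^ 8 = real N powr \<delta>"
      using elim by (simp add: w_def powr_power)
    have "real N = real N powr 1" using elim by simp
    also have "\<dots> \<le> real N powr (\<delta> / 8 * real (8 + j))"
      using elim j assms by (intro powr_mono) (auto simp: field_simps)
    also have "\<dots> = w ^ (8 + j)"
      using elim by (simp add: w_def powr_power mult.commute)
    finally show ?case using *[of w "real N"] elim by (simp add: w8) (simp add: w_def)
  qed
  with c show ?thesis by blast
qed


section \<open>Haar measure on the circle\<close>

interpretation unit_interval: prob_space "uniform_measure lborel {0..1::real}"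
  by (rule prob_space_uniform_measure) auto

lemma uniform_unit_interval_eq_density:
  "uniform_measure lborel {0..1::real} = density lborel (\<lambda>t. ennreal (indicator {0..1} t))"
  by (simp add: uniform_measure_def ennreal_indicator divide_ennreal_def)

lemma cis_measurable [measurable]:
  "(\<lambda>t. cis (2 * pi * t)) \<in> borel_measurable (uniform_measure lborel {0..1::real})"
proof -
  have "(\<lambda>t. cis (2 * pi * t)) \<in> borel_measurable borel"
    by (intro borel_measurable_continuous_onI continuous_intros)
  thus ?thesis by (simp cong: measurable_cong_sets)
qed

lemma sets_circle_haar [measurable_cong, simp]: "sets circle_haar = sets borel"
  and space_circle_haar [simp]: "space circle_haar = UNIV"
  by (simp_all add: circle_haar_def)

interpretation circle_haar: prob_space circle_haar
  unfolding circle_haar_def by (rule unit_interval.prob_space_distr) measurable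

lemma AE_circle_haar_norm: "AE z in circle_haar. norm z = 1"
  unfolding circle_haar_def by (subst AE_distr_iff) auto

lemma integrable_circle_haar_power: "integrable circle_haar (\<lambda>z. z ^ k)"
proof (rule circle_haar.integrable_const_bound[where B = 1])
  show "AE z in circle_haar. norm (z ^ k) \<le> 1"
    using AE_circle_haar_norm by eventually_elim (simp add: norm_power)
qed measurable

text \<open>This orthogonality to constants is what removes the monomials with a free coordinate.
  The antiderivative cis(c t)/(i c) agrees at 0 and 1, as c is a multiple of 2 pi.\<close>

lemma integral_circle_haar_power:
  assumes "k > 0"
  shows "(\<integral>z. z ^ k \<partial>circle_haar) = 0"
proof -
  define c where "c = 2 * pi * real k"
  have c: "c \<noteq> 0" using assms by (simp add: c_def)
  have "(\<integral>z. z ^ k \<partial>circle_haar) = (\<integral>t. cis (2 * pi * t) ^ k \<partial>uniform_measure lborel {0..1::real})"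
    unfolding circle_haar_def by (subst integral_distr) auto
  also have "\<dots> = (\<integral>t. cis (c * t) \<partial>uniform_measure lborel {0..1::real})"
    unfolding c_def by (simp only: Complex.DeMoivre mult_ac)
  also have "\<dots> = (\<integral>t. indicator {0..1} t *\<^sub>R cis (c * t) \<partial>lborel)"
    unfolding uniform_unit_interval_eq_density
    by (subst integral_density) (auto intro!: borel_measurable_continuous_onI continuous_intros)
  also have "\<dots> = cis (c * 1) / (\<i> * c) - cis (c * 0) / (\<i> * c)"
  proof (rule integral_FTC_atLeastAtMost)
    fix x :: real
    have "((\<lambda>t. exp (\<i> * (c * t)) / (\<i> * c)) has_vector_derivative exp (\<i> * (c * x))) (at x within {0..1})"
      using c by (auto intro!: derivative_eq_intros has_vector_derivative_real_field simp: field_simps)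
    thus "((\<lambda>t. cis (c * t) / (\<i> * c)) has_vector_derivative cis (c * x)) (at x within {0..1})"
      by (simp add: cis_conv_exp)
  qed (auto intro!: continuous_intros)
  also have "cis (c * 1) = 1" unfolding c_def using cis_multiple_2pi[of "real k"] by simp
  finally show ?thesis by simp
qed

lemma measure_circle_haar_cball_ge:
  assumes "0 \<le> \<eta>" "\<eta> \<le> 1"
  shows "measure circle_haar (cball 1 \<eta>) \<ge> \<eta> / (2 * pi)"
proof -
  have le: "\<eta> / (2 * pi) \<le> 1" using assms pi_gt3 by (simp add: field_simps)
  \<comment> \<open>A one-sided arc starting at 1 already suffices, because |cis x - 1| is at most
    |x|.\<close>
  have "\<eta> / (2 * pi) = measure (uniform_measure lborel {0..1::real}) {0..\<eta> / (2 * pi)}"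
    using assms le by (subst measure_uniform_measure) (auto simp: Int_absorb1)
  also have "\<dots> \<le> measure (uniform_measure lborel {0..1::real}) ((\<lambda>t. cis (2 * pi * t)) -` cball 1 \<eta> \<inter> space (uniform_measure lborel {0..1::real}))"
  proof (rule unit_interval.finite_measure_mono)
    show "{0..\<eta> / (2 * pi)} \<subseteq> (\<lambda>t. cis (2 * pi * t)) -` cball 1 \<eta> \<inter> space (uniform_measure lborel {0..1::real})"
    proof
      fix t assume t: "t \<in> {0..\<eta> / (2 * pi)}"
      have "norm (cis (2 * pi * t) - cis 0) \<le> \<bar>2 * pi * t - 0\<bar>"
        using dist_exp_i_1[of "2 * pi * t"] abs_sin_x_le_abs_x[of "pi * t"] by (simp add: cis_conv_exp)
      also have "\<dots> \<le> \<eta>" using t by (simp add: field_simps)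
      finally show "t \<in> (\<lambda>t. cis (2 * pi * t)) -` cball 1 \<eta> \<inter> space (uniform_measure lborel {0..1::real})"
        by (simp add: dist_norm norm_minus_commute)
    qed
  qed measurable
  also have "\<dots> = measure circle_haar (cball 1 \<eta>)"
    unfolding circle_haar_def by (subst measure_distr) auto
  finally show ?thesis .
qed

section \<open>Boxes and monomials on the polytorus\<close>

lemma prob_space_torus_haar: "prob_space (torus_haar P)"
  unfolding torus_haar_def by (intro prob_space_PiM circle_haar.prob_space_axioms)

lemma AE_torus_haar_norm:
  assumes "finite P"
  shows "AE z in torus_haar P. \<forall>p\<in>P. norm (z p) = 1"
  unfolding torus_haar_def
  by (intro eventually_ball_finite ballI assms AE_PiM_component circle_haar.prob_space_axioms AE_circle_haar_norm)

text \<open>Coordinates outside S are left free. Since \<open>circle_haar\<close> is a measure on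
  the whole complex plane, planar discs and \<open>UNIV\<close> stand for arcs and the full
  circle.\<close>

definition torus_box :: "nat set \<Rightarrow> nat set \<Rightarrow> real \<Rightarrow> (nat \<Rightarrow> complex) set" where
  "torus_box P S \<eta> = PiE P (\<lambda>p. if p \<in> S then cball 1 \<eta> else UNIV)"

lemma sets_torus_box [measurable]:
  assumes "finite P"
  shows "torus_box P S \<eta> \<in> sets (torus_haar P)"
  unfolding torus_box_def torus_haar_def using assms by (intro sets_PiM_I_finite) auto

lemma measure_torus_box_ge:
  assumes "finite P" "S \<subseteq> P" "0 \<le> \<eta>" "\<eta> \<le> 1"
  shows "measure (torus_haar P) (torus_box P S \<eta>) \<ge> (\<eta> / (2 * pi)) ^ card S"
proof -
  interpret finite_product_prob_space "\<lambda>_::nat. circle_haar" P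
    by standard fact
  have "(\<eta> / (2 * pi)) ^ card S = (\<Prod>p\<in>S. \<eta> / (2 * pi))" by simp
  also have "\<dots> \<le> (\<Prod>p\<in>S. measure circle_haar (cball 1 \<eta>))"
    using assms by (intro prod_mono) (auto intro: measure_circle_haar_cball_ge)
  also have "\<dots> = (\<Prod>p\<in>P. measure circle_haar (if p \<in> S then cball 1 \<eta> else UNIV))"
    using assms circle_haar.prob_space by (intro prod.mono_neutral_cong_left) auto
  also have "\<dots> = measure (torus_haar P) (torus_box P S \<eta>)"
    unfolding torus_box_def torus_haar_def by (subst finite_measure_PiM_emb) auto
  finally show ?thesis .
qed

text \<open>The added factors have exponent 0; primality excludes composite divisors of n. A fixed
  index set lets integrals over the torus factor.\<close>

lemma zmon_superset:
  assumes "finite P" "prime_factors n \<subseteq> P" "\<And>p. p \<in> P \<Longrightarrow> prime p"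
  shows "zmon z n = (\<Prod>p\<in>P. z p ^ multiplicity p n)"
  unfolding zmon_def
  by (rule prod.mono_neutral_left) (use assms in \<open>auto simp: prime_factors_multiplicity\<close>)

lemma measurable_zmon [measurable]:
  assumes "prime_factors n \<subseteq> P"
  shows "(\<lambda>z. zmon z n) \<in> borel_measurable (torus_haar P)"
  unfolding zmon_def torus_haar_def
proof (intro borel_measurable_prod borel_measurable_power)
  fix p assume "p \<in> prime_factors n"
  with assms have "p \<in> P" by auto
  hence "(\<lambda>z. z p) \<in> measurable (PiM P (\<lambda>_. circle_haar)) circle_haar"
    by (rule measurable_component_singleton)
  thus "(\<lambda>z. z p) \<in> borel_measurable (PiM P (\<lambda>_. circle_haar))"
    by (subst measurable_cong_sets[OF refl sets_circle_haar[symmetric]])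
qed

lemma norm_zmon_eq_1:
  assumes "\<forall>p\<in>P. norm (z p) = 1" "prime_factors n \<subseteq> P"
  shows "norm (zmon z n) = 1"
  using assms by (auto simp: zmon_def norm_power simp flip: prod_norm intro!: prod.neutral)

text \<open>Writing k for the number of prime factors with multiplicity, k < 2^k <= n, as every
  prime is at least 2.\<close>

lemma sum_multiplicity_le:
  assumes "n > (0::nat)"
  shows "(\<Sum>p\<in>prime_factors n. multiplicity p n) \<le> n"
proof -
  have "(\<Sum>p\<in>prime_factors n. multiplicity p n) < 2 ^ (\<Sum>p\<in>prime_factors n. multiplicity p n)"
    by (rule less_exp)
  also have "\<dots> = (\<Prod>p\<in>prime_factors n. 2 ^ multiplicity p n)" by (simp add: power_sum)
  also have "\<dots> \<le> (\<Prod>p\<in>prime_factors n. p ^ multiplicity p n)"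
    by (intro prod_mono) (auto intro!: power_mono prime_ge_2_nat)
  also have "\<dots> = n" using assms by (intro prime_factorization_nat[symmetric])
  finally show ?thesis by simp
qed

text \<open>For factors of modulus 1, distances to 1 add up under multiplication, so z(n) is off by
  at most the total exponent times \<open>\<eta>\<close>.\<close>

lemma norm_zmon_diff_1_le:
  assumes "n > 0" "\<And>p. p \<in> prime_factors n \<Longrightarrow> norm (z p) = 1"
    and "\<And>p. p \<in> prime_factors n \<Longrightarrow> norm (z p - 1) \<le> \<eta>" "\<eta> \<ge> 0"
  shows "norm (zmon z n - 1) \<le> real n * \<eta>"
proof -
  have "norm (zmon z n - 1) = norm ((\<Prod>p\<in>prime_factors n. z p ^ multiplicity p n) - (\<Prod>p\<in>prime_factors n. 1))"
    by (simp add: zmon_def)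
  also have "\<dots> \<le> (\<Sum>p\<in>prime_factors n. norm (z p ^ multiplicity p n - 1))"
    using assms by (intro norm_prod_diff) (auto simp: norm_power)
  also have "\<dots> \<le> (\<Sum>p\<in>prime_factors n. real (multiplicity p n) * \<eta>)"
  proof (rule sum_mono)
    fix p assume p: "p \<in> prime_factors n"
    have "norm (z p ^ multiplicity p n - 1 ^ multiplicity p n) \<le> multiplicity p n * norm (z p - 1)"
      using assms(2)[OF p] by (intro norm_power_diff) auto
    also have "\<dots> \<le> multiplicity p n * \<eta>" using assms(3)[OF p] by (intro mult_left_mono) auto
    finally show "norm (z p ^ multiplicity p n - 1) \<le> real (multiplicity p n) * \<eta>" by simp
  qed
  also have "\<dots> = real (\<Sum>p\<in>prime_factors n. multiplicity p n) * \<eta>" by (simp add: sum_distrib_right)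
  also have "\<dots> \<le> real n * \<eta>"
    using sum_multiplicity_le[OF assms(1)] assms(4) by (intro mult_right_mono, subst of_nat_le_iff) auto
  finally show ?thesis .
qed

text \<open>The integral factors over the coordinates. Some prime factor of n lies outside S; its
  coordinate is free and contributes the integral of a positive power over the full circle, which is
  0.\<close>

lemma integral_zmon_box_eq_0:
  assumes P: "finite P" "\<And>p. p \<in> P \<Longrightarrow> prime p" and n: "prime_factors n \<subseteq> P"
    and S: "\<not> prime_factors n \<subseteq> S"
  shows "(\<integral>z. indicator (torus_box P S \<eta>) z *\<^sub>R zmon z n \<partial>torus_haar P) = 0"
proof -
  interpret product_sigma_finite "\<lambda>_::nat. circle_haar" by standard
  define B where "B = (\<lambda>p. if p \<in> S then cball 1 \<eta> else (UNIV :: complex set))"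
  define f where "f = (\<lambda>p z. indicator (B p) z *\<^sub>R z ^ multiplicity p n)"
  have "(\<integral>z. indicator (torus_box P S \<eta>) z *\<^sub>R zmon z n \<partial>torus_haar P)
          = (\<integral>z. (\<Prod>p\<in>P. f p (z p)) \<partial>torus_haar P)"
  proof (rule Bochner_Integration.integral_cong)
    fix z assume z: "z \<in> space (torus_haar P)"
    hence "indicator (torus_box P S \<eta>) z = (\<Prod>p\<in>P. indicator (B p) (z p) :: real)"
      using P(1) unfolding torus_haar_def torus_box_def B_def[symmetric]
      by (auto simp: indicator_def space_PiM PiE_iff prod_zero_iff)
    moreover have "zmon z n = (\<Prod>p\<in>P. z p ^ multiplicity p n)"
      using P n by (intro zmon_superset)
    ultimately show "indicator (torus_box P S \<eta>) z *\<^sub>R zmon z n = (\<Prod>p\<in>P. f p (z p))"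
      by (simp only: f_def prod.distrib scaleR_conv_of_real of_real_prod)
  qed auto
  also have "\<dots> = (\<Prod>p\<in>P. (\<integral>z. f p z \<partial>circle_haar))"
    unfolding torus_haar_def
  proof (rule product_integral_prod[OF P(1)])
    fix p assume "p \<in> P"
    show "integrable circle_haar (f p)" unfolding f_def
      by (intro integrable_mult_indicator integrable_circle_haar_power) (auto simp: B_def)
  qed
  also have "\<dots> = 0"
  proof -
    obtain p where p: "p \<in> prime_factors n" "p \<notin> S" using S by auto
    hence "multiplicity p n > 0" by (auto simp: prime_factors_multiplicity)
    hence "(\<integral>z. f p z \<partial>circle_haar) = 0"
      using p by (simp add: f_def B_def integral_circle_haar_power)
    thus ?thesis using p n P(1) by (auto simp: prod_zero_iff)
  qed
  finally show ?thesis .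
qed

text \<open>The graph of a convex power lies above its tangent at l. After scaling by t = x/l this
  is Bernoulli's inequality, obtained from Young's inequality with weights 1/q and 1 - 1/q.\<close>

lemma powr_ge_tangent:
  fixes x l q :: real
  assumes "x \<ge> 0" "l > 0" "q \<ge> 1"
  shows "x powr q \<ge> l powr q + q * l powr (q - 1) * (x - l)"
proof (cases "x = 0")
  case True
  have "l powr (q - 1) * l = l powr q" using assms by (simp add: powr_diff)
  thus ?thesis using True assms by (simp add: algebra_simps)
next
  case False
  define t where "t = x / l"
  have t: "t > 0" "x = t * l" using False assms by (auto simp: t_def)
  have "t = (t powr q) powr (1 / q) * 1 powr (1 - 1 / q)" using t assms by (simp add: powr_powr)
  also have "\<dots> \<le> (1 / q) * t powr q + (1 - 1 / q) * 1"
    using t assms by (intro Youngs_inequality_0) (auto simp: field_simps)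
  finally have "q * t \<le> q * ((1 / q) * t powr q + (1 - 1 / q) * 1)"
    using assms by (intro mult_left_mono) auto
  also have "\<dots> = t powr q + q - 1" using assms by (simp add: field_simps)
  finally have "l powr q * (1 + q * (t - 1)) \<le> l powr q * t powr q"
    by (intro mult_left_mono) (auto simp: algebra_simps)
  moreover have "l powr q = l powr (q - 1) * l" using assms by (simp add: powr_diff)
  ultimately show ?thesis using t assms by (simp add: powr_mult algebra_simps)
qed

text \<open>This is Jensen's inequality on B, proved by integrating the tangent at l. Nothing is
  divided by the measure of B, so null sets need no separate case.\<close>

lemma (in finite_measure) integral_powr_ge:
  fixes f :: "'a \<Rightarrow> real"
  assumes q: "q \<ge> 1" and l: "l > 0" and B: "B \<in> sets M"
    and nonneg: "\<And>x. f x \<ge> 0" and int: "integrable M f" "integrable M (\<lambda>x. f x powr q)"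
    and mean: "(\<integral>x. indicator B x * f x \<partial>M) \<ge> l * measure M B"
  shows "(\<integral>x. f x powr q \<partial>M) \<ge> l powr q * measure M B"
proof -
  define k where "k = q * l powr (q - 1)"
  have int1: "integrable M (\<lambda>x. indicator B x * f x)"
    using integrable_mult_indicator[OF B int(1)] by simp
  have int2: "integrable M (\<lambda>x. indicator B x * c :: real)" for c
    using B by (intro integrable_mult_left integrable_real_indicator) (auto simp: emeasure_eq_measure)
  \<comment> \<open>Here k is the slope of the tangent, and the added term is nonnegative by
    \<open>mean\<close>. Off B the tangent is replaced by 0.\<close>
  have "l powr q * measure M B \<le> l powr q * measure M B + k * ((\<integral>x. indicator B x * f x \<partial>M) - l * measure M B)"
    using mean q by (simp add: k_def)
  also have "\<dots> = (\<integral>x. indicator B x * (l powr q - k * l) + k * (indicator B x * f x) \<partial>M)"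
    using int1 int2 by (subst Bochner_Integration.integral_add) (auto simp: algebra_simps sets.Int_space_eq2[OF B])
  also have "\<dots> \<le> (\<integral>x. f x powr q \<partial>M)"
  proof (rule integral_mono)
    fix x
    have "l powr q + k * (f x - l) \<le> f x powr q"
      unfolding k_def using powr_ge_tangent[OF nonneg l q] .
    thus "indicator B x * (l powr q - k * l) + k * (indicator B x * f x) \<le> f x powr q"
      by (auto simp: indicator_def algebra_simps)
  qed (intro Bochner_Integration.integrable_add integrable_mult_right int1 int2 int(2))+
  finally show ?thesis .
qed

section \<open>The lower bound for the norm of \<open>F_N\<close>\<close>

lemma prime_factors_subset_primes_upto:
  assumes "n \<in> {1..N}"
  shows "prime_factors n \<subseteq> primes_upto N"
proof
  fix p assume p: "p \<in> prime_factors n"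
  hence "p \<le> n" using assms by (intro dvd_imp_le) auto
  with p assms show "p \<in> primes_upto N" by (auto simp: primes_upto_def)
qed

lemma measurable_F_N: "F_N N \<in> borel_measurable (torus_haar (primes_upto N))"
proof -
  have "(\<lambda>z. \<Sum>n=1..N. zmon z n / complex_of_real (sqrt (real n)))
          \<in> borel_measurable (torus_haar (primes_upto N))"
    by (intro borel_measurable_sum borel_measurable_divide measurable_zmon prime_factors_subset_primes_upto) auto
  thus ?thesis by (simp add: F_N_def [abs_def])
qed

text \<open>A crude bound that serves to establish integrability.\<close>

lemma AE_norm_F_N_le: "AE z in torus_haar (primes_upto N). norm (F_N N z) \<le> real N"
  using AE_torus_haar_norm[OF finite_primes_upto]
proof eventually_elim
  case (elim z)
  have "norm (F_N N z) \<le> (\<Sum>n=1..N. norm (zmon z n / complex_of_real (sqrt (real n))))"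
    unfolding F_N_def by (rule norm_sum)
  also have "\<dots> \<le> (\<Sum>n=1..N. 1)"
    using norm_zmon_eq_1[OF elim prime_factors_subset_primes_upto]
    by (intro sum_mono) (auto simp: norm_divide)
  finally show ?case by simp
qed

lemma integrable_zmon:
  assumes "finite P" "prime_factors n \<subseteq> P"
  shows "integrable (torus_haar P) (\<lambda>z. zmon z n)"
proof -
  interpret prob_space "torus_haar P" by (rule prob_space_torus_haar)
  show ?thesis
  proof (rule integrable_const_bound[where B = 1])
    show "AE z in torus_haar P. norm (zmon z n) \<le> 1"
      using AE_torus_haar_norm[OF assms(1)] by eventually_elim (use norm_zmon_eq_1 assms in force)
  qed (rule measurable_zmon[OF assms(2)])
qed

text \<open>On the box z(n) is within 1/2 of 1, so its real part is at least 1/2. The estimate holds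
  almost everywhere, as the box also contains points off the torus.\<close>

lemma Re_integral_zmon_box_ge:
  assumes P: "finite P" "prime_factors n \<subseteq> P" and n: "n \<ge> 1" "prime_factors n \<subseteq> S"
    and \<eta>: "\<eta> \<ge> 0" "real n * \<eta> \<le> 1 / 2"
  shows "Re (\<integral>z. indicator (torus_box P S \<eta>) z *\<^sub>R zmon z n \<partial>torus_haar P)
           \<ge> measure (torus_haar P) (torus_box P S \<eta>) / 2"
proof -
  interpret prob_space "torus_haar P" by (rule prob_space_torus_haar)
  let ?B = "torus_box P S \<eta>"
  note B = sets_torus_box[OF P(1), of S \<eta>]
  note int = integrable_mult_indicator[OF B integrable_zmon[OF P]]
  have "measure (torus_haar P) ?B / 2 = (\<integral>z. indicator ?B z * (1 / 2) \<partial>torus_haar P)"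
    using B by (simp add: sets.Int_space_eq2)
  also have "\<dots> \<le> (\<integral>z. Re (indicator ?B z *\<^sub>R zmon z n) \<partial>torus_haar P)"
  proof (rule integral_mono_AE)
    show "AE z in torus_haar P. indicator ?B z * (1 / 2) \<le> Re (indicator ?B z *\<^sub>R zmon z n)"
      using AE_torus_haar_norm[OF P(1)]
    proof eventually_elim
      case (elim z)
      have "Re (zmon z n) \<ge> 1 / 2" if z: "z \<in> ?B"
      proof -
        have "norm (z p - 1) \<le> \<eta>" if "p \<in> prime_factors n" for p
        proof -
          have "z p \<in> cball 1 \<eta>" using z that P(2) n(2) by (auto simp: torus_box_def PiE_iff split: if_splits)
          thus ?thesis by (simp add: dist_norm norm_minus_commute)
        qed
        hence "norm (zmon z n - 1) \<le> real n * \<eta>"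
          using elim P n \<eta> by (intro norm_zmon_diff_1_le) auto
        hence "norm (zmon z n - 1) \<le> 1 / 2" using \<eta> by linarith
        thus ?thesis using abs_Re_le_cmod[of "zmon z n - 1"] by simp
      qed
      thus ?case by (auto simp: indicator_def)
    qed
  next
    show "integrable (torus_haar P) (\<lambda>z. indicator ?B z * (1 / 2 :: real))"
      using B by (intro integrable_mult_left integrable_real_indicator) (auto simp: emeasure_eq_measure)
  qed (intro integrable_Re int)
  also have "\<dots> = Re (\<integral>z. indicator ?B z *\<^sub>R zmon z n \<partial>torus_haar P)"
    by (rule integral_Re[OF int])
  finally show ?thesis .
qed

lemma Lq_norm_F_N_ge:
  fixes q y :: real
  assumes N: "N \<ge> 1" and q: "q \<ge> 1"
  defines "P \<equiv> primes_upto N"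
  defines "S \<equiv> {p \<in> P. real p \<le> y}"
  shows "Lq_norm_torus P q (F_N N) \<ge> real (card (smooth_upto y (real N))) / (2 * sqrt (real N)) *
           ((1 / (4 * pi * real N)) ^ card S) powr (1 / q)"
proof -
  interpret prob_space "torus_haar P" by (rule prob_space_torus_haar)
  \<comment> \<open>This makes n \<open>\<eta>\<close> at most 1/2 for every n up to N, and
    \<open>\<eta>\<close> / (2 pi) becomes 1 / (4 pi N).\<close>
  define \<eta> where "\<eta> = 1 / (2 * real N)"
  define B where "B = torus_box P S \<eta>"
  define A where "A = smooth_upto y (real N)"
  \<comment> \<open>A lower bound for the mean of |F_N| over B: each smooth n contributes at least
    1/2 times 1/sqrt N.\<close>
  define l where "l = real (card A) / (2 * sqrt (real N))"
  define g where "g = (\<lambda>n z. indicator B z *\<^sub>R zmon z n)"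
  have finP [simp]: "finite P" by (simp add: P_def)
  have B: "B \<in> sets (torus_haar P)" unfolding B_def by (rule sets_torus_box) simp
  have subP: "prime_factors n \<subseteq> P" if "n \<in> {1..N}" for n
    unfolding P_def using that by (rule prime_factors_subset_primes_upto)
  have A: "A \<subseteq> {1..N}" by (auto simp: A_def smooth_upto_def)
  have S_iff: "prime_factors n \<subseteq> S \<longleftrightarrow> n \<in> A" if "n \<in> {1..N}" for n
    using subP[OF that] that by (auto simp: S_def A_def smooth_upto_def)
  have "1 \<in> A" using N by (auto simp: A_def smooth_upto_def)
  hence "card A > 0" by (subst card_gt_0_iff) (auto simp: A_def)
  hence l: "l > 0" using N by (simp add: l_def)
  have int_F: "integrable (torus_haar P) (F_N N)"
    using AE_norm_F_N_le[of N] measurable_F_N[of N] unfolding P_def[symmetric]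
    by (rule integrable_const_bound)
  have int_F_powr: "integrable (torus_haar P) (\<lambda>z. norm (F_N N z) powr q)"
  proof (rule integrable_const_bound[where B = "real N powr q"])
    show "AE z in torus_haar P. norm (norm (F_N N z) powr q) \<le> real N powr q"
      unfolding P_def using AE_norm_F_N_le by eventually_elim (use q in \<open>auto intro: powr_mono2\<close>)
    show "(\<lambda>z. norm (F_N N z) powr q) \<in> borel_measurable (torus_haar P)"
      using measurable_F_N[of N] unfolding P_def by measurable
  qed
  have int_g: "integrable (torus_haar P) (g n)" if "n \<in> {1..N}" for n
    unfolding g_def using B subP[OF that] by (intro integrable_mult_indicator integrable_zmon) auto

  have "l * measure (torus_haar P) B = (\<Sum>n\<in>A. 1 / sqrt (real N) * (measure (torus_haar P) B / 2))"
    by (simp add: l_def)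
  also have "\<dots> \<le> (\<Sum>n\<in>A. 1 / sqrt (real n) * Re (\<integral>z. g n z \<partial>torus_haar P))"
  proof (intro sum_mono mult_mono)
    fix n assume "n \<in> A"
    with A have n: "n \<in> {1..N}" by auto
    show "1 / sqrt (real N) \<le> 1 / sqrt (real n)" using n by (intro divide_left_mono) auto
    show "measure (torus_haar P) B / 2 \<le> Re (\<integral>z. g n z \<partial>torus_haar P)"
      unfolding g_def B_def using n subP[OF n] S_iff[OF n] \<open>n \<in> A\<close>
      by (intro Re_integral_zmon_box_ge) (auto simp: \<eta>_def field_simps)
  qed auto
  \<comment> \<open>The sum may be extended from smooth n to all n up to N, because the new
    monomials integrate to 0 over B.\<close>
  also have "\<dots> = (\<Sum>n=1..N. 1 / sqrt (real n) * Re (\<integral>z. g n z \<partial>torus_haar P))"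
  proof (rule sum.mono_neutral_left)
    show "\<forall>n\<in>{1..N} - A. 1 / sqrt (real n) * Re (\<integral>z. g n z \<partial>torus_haar P) = 0"
    proof
      fix n assume n: "n \<in> {1..N} - A"
      have "(\<integral>z. g n z \<partial>torus_haar P) = 0"
        unfolding g_def B_def using n subP[of n] S_iff[of n]
        by (intro integral_zmon_box_eq_0) (auto simp: P_def primes_upto_def)
      thus "1 / sqrt (real n) * Re (\<integral>z. g n z \<partial>torus_haar P) = 0" by simp
    qed
  qed (use A in auto)
  also have "\<dots> = Re (\<Sum>n=1..N. (\<integral>z. g n z / complex_of_real (sqrt (real n)) \<partial>torus_haar P))"
    by (simp add: Re_divide_of_real)
  also have "(\<Sum>n=1..N. (\<integral>z. g n z / complex_of_real (sqrt (real n)) \<partial>torus_haar P))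
               = (\<integral>z. (\<Sum>n=1..N. g n z / complex_of_real (sqrt (real n))) \<partial>torus_haar P)"
    by (rule Bochner_Integration.integral_sum[symmetric]) (intro integrable_divide int_g)
  also have "\<dots> = (\<integral>z. indicator B z *\<^sub>R F_N N z \<partial>torus_haar P)"
    by (simp only: g_def F_N_def sum_distrib_left scaleR_conv_of_real times_divide_eq_right)
  also have "Re \<dots> \<le> norm (\<integral>z. indicator B z *\<^sub>R F_N N z \<partial>torus_haar P)" by (rule complex_Re_le_cmod)
  also have "\<dots> \<le> (\<integral>z. norm (indicator B z *\<^sub>R F_N N z) \<partial>torus_haar P)" by (rule integral_norm_bound)
  also have "\<dots> = (\<integral>z. indicator B z * norm (F_N N z) \<partial>torus_haar P)" by simp
  finally have "l powr q * measure (torus_haar P) B \<le> (\<integral>z. norm (F_N N z) powr q \<partial>torus_haar P)"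
    by (intro integral_powr_ge q l B integrable_norm int_F int_F_powr norm_ge_zero)
  hence *: "(l powr q * measure (torus_haar P) B) powr (1 / q) \<le> Lq_norm_torus P q (F_N N)"
    unfolding Lq_norm_torus_def using q by (intro powr_mono2) auto
  have "(1 / (4 * pi * real N)) ^ card S = (\<eta> / (2 * pi)) ^ card S"
    by (simp add: \<eta>_def mult_ac)
  also have "\<dots> \<le> measure (torus_haar P) B"
    unfolding B_def using N by (intro measure_torus_box_ge) (auto simp: S_def \<eta>_def)
  finally have "l * ((1 / (4 * pi * real N)) ^ card S) powr (1 / q)
                  \<le> l * measure (torus_haar P) B powr (1 / q)"
    using l q by (intro mult_left_mono powr_mono2) auto
  also have "\<dots> = (l powr q * measure (torus_haar P) B) powr (1 / q)"
    using l q by (simp add: powr_mult powr_powr)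
  also note *
  finally show ?thesis by (simp add: l_def A_def)
qed

section \<open>Choice of the smoothness bound and the limit in N\<close>

theorem theorem4:
  fixes \<epsilon> :: real
  assumes "\<epsilon> > 0"
  shows "\<exists>C > 0. \<exists>N0. \<forall>N \<ge> N0. \<forall>q :: real. N \<ge> 2 \<and> q \<ge> real N powr \<epsilon> \<longrightarrow>
           Lq_norm_torus (primes_upto N) q (F_N N) \<ge> C * sqrt (real N)"
proof -
  \<comment> \<open>Half of \<open>\<epsilon>\<close> goes into the smoothness bound y; the other
    half makes y/q decay like N^(-\<open>\<delta>\<close>).\<close>
  define \<delta> where "\<delta> = \<epsilon> / 2"
  have \<delta>: "\<delta> > 0" using assms by (simp add: \<delta>_def)
  obtain c where c: "c > 0"
    and smooth: "\<forall>\<^sub>F N in sequentially. c * real N \<le> real (card (smooth_upto (real N powr \<delta>) (real N)))"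
    using card_smooth_upto_ge[OF \<delta>] by blast
  \<comment> \<open>The logarithm of this expression is of order -N^(-\<open>\<delta>\<close>) ln N
    and tends to 0.\<close>
  have "((\<lambda>N::nat. (1 / (4 * pi * real N)) powr (real N powr (-\<delta>))) \<longlongrightarrow> 1) sequentially"
    using \<delta> by real_asymp
  hence "\<forall>\<^sub>F N::nat in sequentially. (1 / (4 * pi * real N)) powr (real N powr (-\<delta>)) > 1 / 2"
    by (rule order_tendstoD) simp
  \<comment> \<open>Since q is quantified inside the eventual statement, the threshold for N is
    uniform in q.\<close>
  with smooth have "\<forall>\<^sub>F N in sequentially. \<forall>q :: real. N \<ge> 2 \<and> q \<ge> real N powr \<epsilon> \<longrightarrow>
           Lq_norm_torus (primes_upto N) q (F_N N) \<ge> c / 4 * sqrt (real N)"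
  proof eventually_elim
    case (elim N)
    show ?case
    proof (intro allI impI, elim conjE)
      fix q :: real
      assume N: "N \<ge> 2" and q: "q \<ge> real N powr \<epsilon>"
      define y where "y = real N powr \<delta>"
      define S where "S = {p \<in> primes_upto N. real p \<le> y}"
      define b where "b = 1 / (4 * pi * real N)"
      have "1 \<le> real N powr \<epsilon>" using N assms by (intro ge_one_powr_ge_zero) auto
      with q have q1: "q \<ge> 1" by linarith
      have "4 * pi * real N \<ge> 1 * 1 * 1" using N pi_gt3 by (intro mult_mono) auto
      hence b: "0 < b" "b \<le> 1" using N by (simp_all add: b_def)
      \<comment> \<open>The trivial bound y for the number of primes up to y is enough.\<close>
      have "S \<subseteq> {1..nat \<lfloor>y\<rfloor>}" by (auto simp: S_def primes_upto_def le_nat_floor dest: prime_ge_1_nat)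
      from card_mono[OF _ this] have "card S \<le> nat \<lfloor>y\<rfloor>" by simp
      also have "real (nat \<lfloor>y\<rfloor>) \<le> y" by (simp add: y_def)
      finally have "real (card S) \<le> y" by simp
      hence "real (card S) * (1 / q) \<le> y * (1 / real N powr \<epsilon>)"
        using q q1 N by (intro mult_mono divide_left_mono) (auto simp: y_def)
      also have "\<dots> = real N powr (-\<delta>)"
        using N by (simp add: y_def \<delta>_def flip: powr_diff)
      \<comment> \<open>The order reverses since b is at most 1.\<close>
      finally have "b powr (real N powr (-\<delta>)) \<le> b powr (real (card S) * (1 / q))"
        using b by (intro powr_mono') auto
      also have "\<dots> = (b ^ card S) powr (1 / q)"
        using b by (simp add: powr_powr flip: powr_realpow)
      finally have box: "1 / 2 \<le> (b ^ card S) powr (1 / q)" using elim(2) by (simp add: b_def)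
      \<comment> \<open>One factor 1/2 comes from the real parts on the box, the other from the
        measure of the box.\<close>
      have "c / 4 * sqrt (real N) = c * real N / (2 * sqrt (real N)) * (1 / 2)"
        using N by (simp add: field_simps flip: power2_eq_square)
      also have "\<dots> \<le> real (card (smooth_upto y (real N))) / (2 * sqrt (real N)) * ((b ^ card S) powr (1 / q))"
        using elim(1) box c by (intro mult_mono divide_right_mono) (auto simp: y_def)
      also have "\<dots> \<le> Lq_norm_torus (primes_upto N) q (F_N N)"
        unfolding b_def S_def using Lq_norm_F_N_ge[of N q y] N q1 by simp
      finally show "c / 4 * sqrt (real N) \<le> Lq_norm_torus (primes_upto N) q (F_N N)" .
    qed
  qed
  then obtain N0 where "\<forall>N\<ge>N0. \<forall>q :: real. N \<ge> 2 \<and> q \<ge> real N powr \<epsilon> \<longrightarrow>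
           Lq_norm_torus (primes_upto N) q (F_N N) \<ge> c / 4 * sqrt (real N)"
    unfolding eventually_sequentially by blast
  moreover have "c / 4 > 0" using c by simp
  ultimately show ?thesis by blast
qed

end
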